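(* Let $(Z_n)_{n\in\mathbb N}\subset L^2(\Omega,\mathcal A,\mathbb P)$ be such that $\mathbb E Z_n=0$ for every $n\in\mathbb N$. Suppose that $$\sum_{k=0}^\infty\Big(\sum_{n=0}^\infty\|\mathcal D_{n+k}Z_n\|_2^2\Big)^{1/2}<\infty\qquad\text{and}\qquad \sum_{k=1}^\infty\Big(\sum_{n=0}^\infty\|\mathcal D_nZ_{n+k}\|_2^2\Big)^{1/2}<\infty .$$ Then the series $\sum_{n\in\mathbb N}Z_n$ converges $\mathbb P$-almost surely and in $L^2(\Omega,\mathcal A,\mathbb P)$.
   Context: $\mathbb N=\{0,1,2,\dots\}$. $(\Omega,\mathcal A,\mathbb P)$ is a probability space and $(\mathcal A_n)_{n\in\mathbb N}$ is an increasing sequence of sub-$\sigma$-algebras of $\mathcal A$ with $\mathcal A_0=\{\emptyset,\Omega\}$ and $\bigvee_{n\ge 0}\mathcal A_n=\mathcal A$. Write $\mathbb E^n:=\mathbb E(\cdot\,|\,\mathcal A_n)$ and $\mathcal D_n:=\mathbb E^{n+1}-\mathbb E^n$ for $n\in\mathbb N$. $\|\cdot\|_2$ is the norm of $L^2(\Omega,\mathcal A,\mathbb P)$. *)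

theory Defs
  imports "HOL-Probability.Probability"
begin

definition L2_space :: "'a measure \<Rightarrow> ('a \<Rightarrow> real) set" where
  "L2_space M = {f \<in> borel_measurable M. integrable M (\<lambda>x. (f x)\<^sup>2)}"

(* Meaningful only for f in L2_space M: the integral of a non-integrable function is 0. *)
definition L2_norm :: "'a measure \<Rightarrow> ('a \<Rightarrow> real) \<Rightarrow> real" where
  "L2_norm M f = sqrt (\<integral>x. (f x)\<^sup>2 \<partial>M)"

definition L2_tendsto :: "'a measure \<Rightarrow> (nat \<Rightarrow> 'a \<Rightarrow> real) \<Rightarrow> ('a \<Rightarrow> real) \<Rightarrow> bool" where
  "L2_tendsto M f g \<longleftrightarrow>
     (\<forall>n. f n \<in> L2_space M) \<and> g \<in> L2_space M \<and>
     (\<lambda>n. L2_norm M (\<lambda>x. f n x - g x)) \<longlonglongrightarrow> 0"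

definition cond_exp_diff ::
  "'a measure \<Rightarrow> (nat \<Rightarrow> 'a measure) \<Rightarrow> nat \<Rightarrow> ('a \<Rightarrow> real) \<Rightarrow> 'a \<Rightarrow> real" where
  "cond_exp_diff M F n f =
     (\<lambda>x. real_cond_exp M (F (Suc n)) f x - real_cond_exp M (F n) f x)"

(* (\<Sum>k. (\<Sum>n. a k n)^(1/2)) < \<infinity> for nonnegative a. In the extended nonnegative reals this
   forces every inner sum to be finite; over the reals that has to be said, because suminf is
   an arbitrary real number on a divergent series. *)
definition sqrt_sums_finite :: "(nat \<Rightarrow> nat \<Rightarrow> real) \<Rightarrow> bool" where
  "sqrt_sums_finite a \<longleftrightarrow> (\<forall>k. summable (a k)) \<and> summable (\<lambda>k. sqrt (\<Sum>n. a k n))"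

end

theory Submission
  imports Defs
begin

text \<open>
  Write \<open>E\<^sup>n\<close> for the conditional expectation given \<open>F n\<close> and \<open>D\<^sub>n = E\<^sup>n\<^sup>+\<^sup>1 - E\<^sup>n\<close>. A centered
  \<open>Z\<^sub>n\<close> is the sum of all its pieces \<open>D\<^sub>j Z\<^sub>n\<close>. Group the pieces by the offset between \<open>j\<close> and \<open>n\<close>:
  along each diagonal, that is, for fixed \<open>k\<close>, the functions \<open>D\<^sub>n\<^sub>+\<^sub>k Z\<^sub>n\<close> are martingale differences in
  \<open>n\<close>, and so are the functions \<open>D\<^sub>n\<^sub>-\<^sub>k\<^sub>-\<^sub>1 Z\<^sub>n\<close> for \<open>n > k\<close>. Doob's \<open>L\<^sup>2\<close> inequality
  (\<open>martingale_maximal_inequality\<close>) bounds the maximal partial sum of a diagonal by twice the square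
  root of its energy, and the two hypotheses say that these bounds are summable over the diagonals.
  Adding them up bounds \<open>max\<^sub>N |Z\<^sub>0 + \<dots> + Z\<^sub>N|\<close> in \<open>L\<^sup>2\<close> by twice the sum of the two quantities that are
  assumed finite; this is \<open>maximal_inequality\<close>.

  To work with finitely many diagonals at a time, \<open>Z\<^sub>n\<close> is first replaced by \<open>E\<^sup>n\<^sup>+\<^sup>K Z\<^sub>n\<close>, and the error
  disappears as \<open>K \<rightarrow> \<infinity>\<close> because \<open>E\<^sup>n f \<rightarrow> f\<close> in \<open>L\<^sup>2\<close> (\<open>cond_exp_tendsto_L2\<close>).

  Applied to the sequence that vanishes before time \<open>m\<close> and agrees with \<open>Z\<close> afterwards, the maximal
  inequality controls the oscillation of the partial sums after time \<open>m\<close>. By dominated convergence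
  for series (\<open>sqrt_sums_tendsto_zero\<close>) this control tends to zero as \<open>m \<rightarrow> \<infinity>\<close>, which yields
  almost sure and \<open>L\<^sup>2\<close> convergence together (\<open>series_converges_of_maximal_tails\<close>).
\<close>

section \<open>Square-integrable functions\<close>

lemma L2_spaceD [dest]:
  assumes "f \<in> L2_space M"
  shows "f \<in> borel_measurable M" "integrable M (\<lambda>x. (f x)\<^sup>2)"
  using assms by (auto simp: L2_space_def)

lemma L2_space_dominated:
  assumes "f \<in> L2_space M" "g \<in> borel_measurable M" "AE x in M. \<bar>g x\<bar> \<le> \<bar>f x\<bar>"
  shows "g \<in> L2_space M"
proof -
  have "integrable M (\<lambda>x. (g x)\<^sup>2)"
    by (rule Bochner_Integration.integrable_bound[OF L2_spaceD(2)[OF assms(1)]])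
       (use assms(2,3) in \<open>auto simp: abs_le_square_iff[symmetric]\<close>)
  then show ?thesis using assms(2) by (simp add: L2_space_def)
qed

lemma L2_space_integrable_mult:
  assumes "f \<in> L2_space M" "g \<in> L2_space M"
  shows "integrable M (\<lambda>x. f x * g x)"
proof (rule Bochner_Integration.integrable_bound)
  show "integrable M (\<lambda>x. (f x)\<^sup>2 + (g x)\<^sup>2)"
    using assms by (auto intro!: Bochner_Integration.integrable_add)
  have "\<bar>a * b\<bar> \<le> a\<^sup>2 + b\<^sup>2" for a b :: real
  proof -
    have "2 * (\<bar>a\<bar> * \<bar>b\<bar>) \<le> a\<^sup>2 + b\<^sup>2"
      using sum_squares_bound[of "\<bar>a\<bar>" "\<bar>b\<bar>"] by simp
    moreover have "0 \<le> \<bar>a\<bar> * \<bar>b\<bar>" by simp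
    ultimately show ?thesis unfolding abs_mult by linarith
  qed
  then show "AE x in M. norm (f x * g x) \<le> norm ((f x)\<^sup>2 + (g x)\<^sup>2)"
    by simp
qed (use assms in \<open>auto dest!: L2_spaceD(1)\<close>)

lemma L2_space_add:
  assumes "f \<in> L2_space M" "g \<in> L2_space M"
  shows "(\<lambda>x. f x + g x) \<in> L2_space M"
proof -
  have "integrable M (\<lambda>x. (f x)\<^sup>2 + (g x)\<^sup>2 + 2 * (f x * g x))"
    using assms L2_space_integrable_mult[OF assms]
    by (auto intro!: Bochner_Integration.integrable_add)
  then show ?thesis
    using assms by (auto simp: L2_space_def power2_sum algebra_simps)
qed

lemma L2_space_cmult: "f \<in> L2_space M \<Longrightarrow> (\<lambda>x. c * f x) \<in> L2_space M" for c :: real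
  by (auto simp: L2_space_def power_mult_distrib)

lemma L2_space_diff:
  assumes "f \<in> L2_space M" "g \<in> L2_space M"
  shows "(\<lambda>x. f x - g x) \<in> L2_space M"
  using L2_space_add[OF assms(1) L2_space_cmult[OF assms(2), of "-1"]] by simp

lemma L2_space_zero: "(\<lambda>x. 0) \<in> L2_space M"
  by (simp add: L2_space_def)

lemma L2_space_sum:
  assumes "\<And>i. i \<in> I \<Longrightarrow> f i \<in> L2_space M"
  shows "(\<lambda>x. \<Sum>i\<in>I. f i x) \<in> L2_space M"
  using assms
  by (induction I rule: infinite_finite_induct) (auto intro: L2_space_add L2_space_zero)

lemma L2_space_abs: "f \<in> L2_space M \<Longrightarrow> (\<lambda>x. \<bar>f x\<bar>) \<in> L2_space M"
  by (auto simp: L2_space_def)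

lemma L2_norm_power2: "(L2_norm M f)\<^sup>2 = (\<integral>x. (f x)\<^sup>2 \<partial>M)"
  by (simp add: L2_norm_def)

lemma L2_norm_nonneg: "0 \<le> L2_norm M f"
  by (simp add: L2_norm_def)

lemma L2_norm_zero: "L2_norm M (\<lambda>x. 0) = 0"
  by (simp add: L2_norm_def)

lemma L2_norm_mono:
  assumes "g \<in> L2_space M" "f \<in> borel_measurable M" "AE x in M. \<bar>f x\<bar> \<le> \<bar>g x\<bar>"
  shows "L2_norm M f \<le> L2_norm M g"
  unfolding L2_norm_def
  by (intro real_sqrt_le_mono integral_mono_AE L2_spaceD(2) L2_space_dominated[OF assms] assms(1))
     (use assms(3) in \<open>auto simp: abs_le_square_iff[symmetric]\<close>)

lemma L2_norm_cmult: "L2_norm M (\<lambda>x. c * f x) = \<bar>c\<bar> * L2_norm M f" for c :: real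
  by (simp add: L2_norm_def power_mult_distrib real_sqrt_mult)

text \<open>
  For \<open>p, q > 0\<close>, convexity of the square gives the pointwise bound
  \<open>(a + b)\<^sup>2 \<le> (p + q) (a\<^sup>2 / p + b\<^sup>2 / q)\<close>. Integrating it with \<open>p\<close> and \<open>q\<close>
  slightly above the norms of the two functions yields Minkowski's inequality without a separate
  treatment of functions of norm zero.
\<close>

lemma L2_norm_triangle:
  assumes f: "f \<in> L2_space M" and g: "g \<in> L2_space M"
  shows "L2_norm M (\<lambda>x. f x + g x) \<le> L2_norm M f + L2_norm M g"
proof (rule field_le_epsilon)
  fix e :: real assume "e > 0"
  define p where "p = L2_norm M f + e / 2"
  define q where "q = L2_norm M g + e / 2"
  have p: "p > 0" "L2_norm M f \<le> p" and q: "q > 0" "L2_norm M g \<le> q"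
    using \<open>e > 0\<close> L2_norm_nonneg[of M f] L2_norm_nonneg[of M g] by (auto simp: p_def q_def)
  have convex: "(a + b)\<^sup>2 \<le> (p + q) * (a\<^sup>2 / p + b\<^sup>2 / q)" for a b :: real
  proof -
    have "(p + q) * (a\<^sup>2 / p + b\<^sup>2 / q) - (a + b)\<^sup>2 = (q * a - p * b)\<^sup>2 / (p * q)"
      using p(1) q(1) by (simp add: field_simps power2_eq_square)
    also have "\<dots> \<ge> 0" using p(1) q(1) by simp
    finally show ?thesis by simp
  qed
  have "(\<integral>x. (f x + g x)\<^sup>2 \<partial>M) \<le> (\<integral>x. (p + q) * ((f x)\<^sup>2 / p + (g x)\<^sup>2 / q) \<partial>M)"
    using L2_spaceD(2)[OF L2_space_add[OF f g]] L2_spaceD(2)[OF f] L2_spaceD(2)[OF g]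
    by (intro integral_mono convex) auto
  also have "\<dots> = (p + q) * ((L2_norm M f)\<^sup>2 / p + (L2_norm M g)\<^sup>2 / q)"
    using L2_spaceD(2)[OF f] L2_spaceD(2)[OF g] by (simp add: L2_norm_power2)
  also have "\<dots> \<le> (p + q) * (p\<^sup>2 / p + q\<^sup>2 / q)"
    using p q L2_norm_nonneg[of M f] L2_norm_nonneg[of M g]
    by (intro mult_left_mono add_mono divide_right_mono power_mono) auto
  also have "\<dots> = (p + q)\<^sup>2"
    using p(1) q(1) by (simp add: power2_eq_square)
  finally have "L2_norm M (\<lambda>x. f x + g x) \<le> p + q"
    unfolding L2_norm_def using p(1) q(1) by (simp add: real_le_lsqrt)
  then show "L2_norm M (\<lambda>x. f x + g x) \<le> L2_norm M f + L2_norm M g + e"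
    by (simp add: p_def q_def)
qed

lemma L2_norm_triangle_sum:
  assumes "\<And>i. i \<in> I \<Longrightarrow> f i \<in> L2_space M"
  shows "L2_norm M (\<lambda>x. \<Sum>i\<in>I. f i x) \<le> (\<Sum>i\<in>I. L2_norm M (f i))"
  using assms
proof (induction I rule: infinite_finite_induct)
  case (insert i I)
  then have "L2_norm M (\<lambda>x. f i x + (\<Sum>i\<in>I. f i x)) \<le> L2_norm M (f i) + L2_norm M (\<lambda>x. \<Sum>i\<in>I. f i x)"
    by (intro L2_norm_triangle L2_space_sum) auto
  with insert show ?case by fastforce
qed (auto simp: L2_norm_zero)

lemma L2_dominated_convergence:
  assumes w: "w \<in> L2_space M"
    and f: "f \<in> borel_measurable M" and s: "\<And>i. s i \<in> borel_measurable M"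
    and lim: "\<And>x. x \<in> space M \<Longrightarrow> (\<lambda>i. s i x) \<longlonglongrightarrow> f x"
    and bound: "\<And>i x. x \<in> space M \<Longrightarrow> \<bar>s i x\<bar> \<le> w x"
  shows "(\<lambda>i. L2_norm M (\<lambda>x. f x - s i x)) \<longlonglongrightarrow> 0"
proof -
  have "(\<lambda>i. \<integral>x. (f x - s i x)\<^sup>2 \<partial>M) \<longlonglongrightarrow> (\<integral>x. 0 \<partial>M)"
  proof (rule integral_dominated_convergence)
    show "integrable M (\<lambda>x. (2 * w x)\<^sup>2)"
      using L2_spaceD(2)[OF L2_space_cmult[OF w]] .
    show "AE x in M. (\<lambda>i. (f x - s i x)\<^sup>2) \<longlonglongrightarrow> 0"
    proof (rule AE_I2)
      fix x assume "x \<in> space M"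
      from tendsto_power[OF tendsto_diff[OF tendsto_const lim[OF this]], of "f x" 2]
      show "(\<lambda>i. (f x - s i x)\<^sup>2) \<longlonglongrightarrow> 0" by simp
    qed
    show "AE x in M. norm ((f x - s i x)\<^sup>2) \<le> (2 * w x)\<^sup>2" for i
    proof (rule AE_I2)
      fix x assume x: "x \<in> space M"
      have "\<bar>f x\<bar> \<le> w x"
        by (rule LIMSEQ_le_const2[OF tendsto_rabs[OF lim[OF x]]]) (use bound[OF x] in auto)
      with bound[OF x, of i] have "\<bar>f x - s i x\<bar> \<le> \<bar>2 * w x\<bar>" by linarith
      then show "norm ((f x - s i x)\<^sup>2) \<le> (2 * w x)\<^sup>2"
        by (simp add: abs_le_square_iff)
    qed
  qed (use f s in auto)
  from tendsto_real_sqrt[OF this] show ?thesis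
    by (simp add: L2_norm_def)
qed


section \<open>A maximal inequality for orthogonal increments\<close>

definition running_max :: "(nat \<Rightarrow> real) \<Rightarrow> nat \<Rightarrow> real" where
  "running_max s N = Max ((\<lambda>n. \<bar>s n\<bar>) ` {..N})"

lemma running_max_cong: "(\<And>n. n \<le> N \<Longrightarrow> s n = t n) \<Longrightarrow> running_max s N = running_max t N"
  by (simp add: running_max_def)

lemma running_max_le_iff: "running_max s N \<le> c \<longleftrightarrow> (\<forall>n\<le>N. \<bar>s n\<bar> \<le> c)"
  by (auto simp: running_max_def)

lemma abs_le_running_max: "n \<le> N \<Longrightarrow> \<bar>s n\<bar> \<le> running_max s N"
  using running_max_le_iff[of s N "running_max s N"] by simp

lemma running_max_0: "running_max s 0 = \<bar>s 0\<bar>"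
  by (simp add: running_max_def)

lemma running_max_Suc: "running_max s (Suc N) = max \<bar>s (Suc N)\<bar> (running_max s N)"
  by (simp add: running_max_def atMost_Suc)

lemma running_max_nonneg: "0 \<le> running_max s N"
  using abs_le_running_max[of 0 N s] by linarith

lemma running_max_add:
  "running_max (\<lambda>n. s n + t n) N \<le> running_max s N + running_max t N"
  unfolding running_max_le_iff
  by (intro allI impI order_trans[OF abs_triangle_ineq] add_mono abs_le_running_max)

lemma running_max_sum:
  "running_max (\<lambda>n. \<Sum>k\<in>K. s k n) N \<le> (\<Sum>k\<in>K. running_max (s k) N)"
  unfolding running_max_le_iff
  by (intro allI impI order_trans[OF sum_abs] sum_mono abs_le_running_max)

lemma measurable_running_max [measurable]:
  assumes [measurable]: "\<And>n. n \<le> N \<Longrightarrow> s n \<in> borel_measurable M"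
  shows "(\<lambda>x. running_max (\<lambda>n. s n x) N) \<in> borel_measurable M"
  unfolding running_max_def by (rule borel_measurable_Max) auto

lemma L2_space_running_max:
  assumes "\<And>n. n \<le> N \<Longrightarrow> s n \<in> L2_space M"
  shows "(\<lambda>x. running_max (\<lambda>n. s n x) N) \<in> L2_space M"
proof (rule L2_space_dominated)
  show "(\<lambda>x. \<Sum>n\<le>N. \<bar>s n x\<bar>) \<in> L2_space M"
    by (intro L2_space_sum L2_space_abs assms) auto
  show "(\<lambda>x. running_max (\<lambda>n. s n x) N) \<in> borel_measurable M"
    using assms by (intro measurable_running_max) auto
  have "running_max (\<lambda>n. s n x) N \<le> (\<Sum>n\<le>N. \<bar>s n x\<bar>)" for x
    unfolding running_max_le_iff by (intro allI impI member_le_sum) auto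
  then show "AE x in M. \<bar>running_max (\<lambda>n. s n x) N\<bar> \<le> \<bar>\<Sum>n\<le>N. \<bar>s n x\<bar>\<bar>"
    by (simp add: running_max_nonneg abs_of_nonneg sum_nonneg)
qed

text \<open>
  This is Doob's \<open>L\<^sup>2\<close> inequality before taking expectations: the sum on the right is a
  discrete stochastic integral against the increments of \<open>s\<close>, whose integrand at time \<open>n\<close> depends
  on \<open>s 0, \<dots>, s n\<close> only, so that its mean vanishes when \<open>s\<close> is a martingale.
\<close>

lemma running_max_pathwise:
  fixes s :: "nat \<Rightarrow> real"
  assumes "s 0 = 0"
  shows "(running_max s N)\<^sup>2 \<le>
    4 * (s N)\<^sup>2 - 4 * (\<Sum>n<N. running_max s n * sgn (s n) * (s (Suc n) - s n))"
proof -
  let ?I = "\<lambda>N. \<Sum>n<N. running_max s n * sgn (s n) * (s (Suc n) - s n)"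
  \<comment> \<open>When a step leaves the maximum unchanged, the bound is kept because \<open>\<bar>s\<bar>\<close> grows at least by
     \<open>sgn (s n)\<close> times the increment; when it raises the maximum from \<open>m\<close> to \<open>m'\<close>, by \<open>2 m m' \<le> m\<^sup>2 + m'\<^sup>2\<close>.\<close>
  have "(running_max s N)\<^sup>2 \<le> 2 * running_max s N * \<bar>s N\<bar> - 2 * ?I N"
  proof (induction N)
    case 0
    show ?case by (simp add: running_max_0 assms)
  next
    case (Suc N)
    define m where "m = running_max s N"
    have m: "0 \<le> m" "\<bar>s N\<bar> \<le> m"
      using running_max_nonneg abs_le_running_max by (auto simp: m_def)
    have sgn_self: "sgn (s N) * s N = \<bar>s N\<bar>"
      by (simp add: abs_sgn mult.commute)
    have sgn_le: "sgn (s N) * s (Suc N) \<le> \<bar>s (Suc N)\<bar>"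
      by (auto simp: sgn_real_def)
    have step: "m * sgn (s N) * (s (Suc N) - s N) \<le> m * \<bar>s (Suc N)\<bar> - m * \<bar>s N\<bar>"
      using mult_left_mono[OF sgn_le m(1)] sgn_self by (simp add: algebra_simps)
    show ?case
    proof (cases "\<bar>s (Suc N)\<bar> \<le> m")
      case True
      then have "running_max s (Suc N) = m"
        by (simp add: running_max_Suc m_def)
      then show ?thesis
        using Suc step by (simp add: m_def algebra_simps)
    next
      case False
      then have "running_max s (Suc N) = \<bar>s (Suc N)\<bar>"
        by (simp add: running_max_Suc m_def)
      moreover have "2 * m * \<bar>s (Suc N)\<bar> \<le> m\<^sup>2 + \<bar>s (Suc N)\<bar>\<^sup>2"
        using sum_squares_bound[of m "\<bar>s (Suc N)\<bar>"] by simp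
      ultimately show ?thesis
        using Suc step by (simp add: m_def algebra_simps power2_eq_square)
    qed
  qed
  \<comment> \<open>Half of the squared maximum is absorbed into the left-hand side, which costs the factor 4.\<close>
  moreover have "2 * running_max s N * \<bar>s N\<bar> \<le> (running_max s N)\<^sup>2 / 2 + 2 * (s N)\<^sup>2"
    using sum_squares_bound[of "running_max s N" "2 * \<bar>s N\<bar>"] by (simp add: power_mult_distrib)
  ultimately show ?thesis by argo
qed

text \<open>
  Integrate the pathwise bound. The integrand \<open>h n\<close> of the stochastic integral is measurable with respect to
  \<open>G n\<close>, so orthogonality makes the integral vanish in mean, and only the energy of the last partial
  sum remains. The martingale property is stated as orthogonality of \<open>d n\<close> to \<open>L\<^sup>2(G n)\<close>, with a
  \<open>\<sigma>\<close>-algebra \<open>G n\<close> for each \<open>n\<close>, because the diagonals below live on shifts and delays of one filtration.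
\<close>

lemma martingale_maximal_inequality:
  assumes d: "\<And>n. d n \<in> L2_space M"
    and sub: "\<And>n. subalgebra M (G n)"
    and adapted: "\<And>i n. i < n \<Longrightarrow> d i \<in> borel_measurable (G n)"
    and orth: "\<And>n h. h \<in> L2_space M \<Longrightarrow> h \<in> borel_measurable (G n) \<Longrightarrow> (\<integral>x. h x * d n x \<partial>M) = 0"
  shows "L2_norm M (\<lambda>x. running_max (\<lambda>N. \<Sum>n<N. d n x) P) \<le> 2 * sqrt (\<Sum>n<P. (L2_norm M (d n))\<^sup>2)"
proof -
  define S where "S = (\<lambda>N x. \<Sum>n<N. d n x)"
  define h where "h = (\<lambda>n x. running_max (\<lambda>N. S N x) n * sgn (S n x))"
  have S_L2: "S N \<in> L2_space M" for N
    unfolding S_def by (intro L2_space_sum d)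
  have S_adapted: "S i \<in> borel_measurable (G n)" if "i \<le> n" for i n
    unfolding S_def using that by (intro borel_measurable_sum adapted) auto
  have max_L2: "(\<lambda>x. running_max (\<lambda>N. S N x) n) \<in> L2_space M" for n
    by (intro L2_space_running_max S_L2)
  have h_adapted: "h n \<in> borel_measurable (G n)" for n
    unfolding h_def using S_adapted
    by (intro borel_measurable_times measurable_running_max borel_measurable_sgn) auto
  have h_L2: "h n \<in> L2_space M" for n
    by (rule L2_space_dominated[OF max_L2 measurable_from_subalg[OF sub h_adapted]])
       (auto simp: h_def abs_mult sgn_real_def)
  have energy: "(\<integral>x. (S N x)\<^sup>2 \<partial>M) = (\<Sum>n<N. (L2_norm M (d n))\<^sup>2)" for N
  proof (induction N)
    case (Suc N)
    have "(\<integral>x. (S (Suc N) x)\<^sup>2 \<partial>M) = (\<integral>x. (S N x)\<^sup>2 + (d N x)\<^sup>2 + 2 * (S N x * d N x) \<partial>M)"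
      by (simp add: S_def power2_sum algebra_simps)
    also have "\<dots> = (\<integral>x. (S N x)\<^sup>2 \<partial>M) + (\<integral>x. (d N x)\<^sup>2 \<partial>M) + 2 * (\<integral>x. S N x * d N x \<partial>M)"
      using L2_spaceD(2)[OF S_L2] L2_spaceD(2)[OF d] L2_space_integrable_mult[OF S_L2 d] by simp
    also have "(\<integral>x. S N x * d N x \<partial>M) = 0"
      by (intro orth S_L2 S_adapted order_refl)
    finally show ?case
      using Suc by (simp add: L2_norm_power2)
  qed (simp add: S_def)
  have "(\<integral>x. (running_max (\<lambda>N. S N x) P)\<^sup>2 \<partial>M) \<le> (\<integral>x. 4 * (S P x)\<^sup>2 - 4 * (\<Sum>n<P. h n x * d n x) \<partial>M)"
  proof (rule integral_mono)
    fix x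
    show "(running_max (\<lambda>N. S N x) P)\<^sup>2 \<le> 4 * (S P x)\<^sup>2 - 4 * (\<Sum>n<P. h n x * d n x)"
      using running_max_pathwise[of "\<lambda>N. S N x" P] by (simp add: S_def h_def)
  qed (use L2_spaceD(2)[OF max_L2] L2_spaceD(2)[OF S_L2] L2_space_integrable_mult[OF h_L2 d] in auto)
  also have "\<dots> = 4 * (\<integral>x. (S P x)\<^sup>2 \<partial>M) - 4 * (\<Sum>n<P. \<integral>x. h n x * d n x \<partial>M)"
    using L2_spaceD(2)[OF S_L2] L2_space_integrable_mult[OF h_L2 d] by simp
  also have "\<dots> = 4 * (\<Sum>n<P. (L2_norm M (d n))\<^sup>2)"
    by (simp add: energy orth[OF h_L2 h_adapted])
  finally have "L2_norm M (\<lambda>x. running_max (\<lambda>N. S N x) P) \<le> sqrt (4 * (\<Sum>n<P. (L2_norm M (d n))\<^sup>2))"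
    unfolding L2_norm_def[of M "\<lambda>x. running_max (\<lambda>N. S N x) P"] by (rule real_sqrt_le_mono)
  then show ?thesis
    by (simp add: S_def real_sqrt_mult)
qed


section \<open>Conditional expectation as an orthogonal projection\<close>

context prob_space
begin

lemma L2_space_const: "(\<lambda>x. c) \<in> L2_space M" for c :: real
  by (simp add: L2_space_def)

lemma L2_space_indicator: "A \<in> sets M \<Longrightarrow> indicator A \<in> L2_space M"
  by (rule L2_space_dominated[OF L2_space_const[of 1]]) (auto simp: indicator_def)

lemma L2_space_integrable: "f \<in> L2_space M \<Longrightarrow> integrable M f"
  using L2_space_integrable_mult[OF _ L2_space_const[of 1]] by simp

lemma sigma_finite_subalgebra_prob: "subalgebra M G \<Longrightarrow> sigma_finite_subalgebra M G"
  by (intro finite_measure_subalgebra_is_sigma_finite finite_measure_subalgebra.intro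
      finite_measure_axioms finite_measure_subalgebra_axioms.intro)

lemma L2_space_cond_exp:
  assumes "subalgebra M G" "f \<in> L2_space M"
  shows "real_cond_exp M G f \<in> L2_space M"
proof -
  interpret sigma_finite_subalgebra M G by (rule sigma_finite_subalgebra_prob[OF assms(1)])
  have "integrable M (\<lambda>x. (real_cond_exp M G f x)\<^sup>2)"
    using L2_space_integrable[OF assms(2)] L2_spaceD(2)[OF assms(2)] emeasure_space_1
    by (intro integrable_convex_cond_exp[where I = UNIV] convex_power2) auto
  then show ?thesis by (simp add: L2_space_def)
qed

lemma cond_exp_inner:
  assumes "subalgebra M G" "f \<in> L2_space M" "h \<in> L2_space M" "h \<in> borel_measurable G"
  shows "(\<integral>x. h x * real_cond_exp M G f x \<partial>M) = (\<integral>x. h x * f x \<partial>M)"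
proof -
  interpret sigma_finite_subalgebra M G by (rule sigma_finite_subalgebra_prob[OF assms(1)])
  show ?thesis
    by (intro real_cond_exp_intg L2_space_integrable_mult assms L2_spaceD(1))
qed

text \<open>
  Conditional expectation is the orthogonal projection onto \<open>L\<^sup>2(G)\<close>. This minimality is what turns
  density of \<open>\<Union>n. L\<^sup>2(F n)\<close> into convergence of the conditional expectations.
\<close>

lemma cond_exp_best_approximation:
  assumes G: "subalgebra M G" and f: "f \<in> L2_space M"
    and g: "g \<in> L2_space M" "g \<in> borel_measurable G"
  shows "L2_norm M (\<lambda>x. f x - real_cond_exp M G f x) \<le> L2_norm M (\<lambda>x. f x - g x)"
proof -
  define E where "E = real_cond_exp M G f"
  have E: "E \<in> L2_space M" "E \<in> borel_measurable G"
    using L2_space_cond_exp[OF G f] by (auto simp: E_def)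
  define h where "h = (\<lambda>x. E x - g x)"
  have h: "h \<in> L2_space M" "h \<in> borel_measurable G"
    using E g L2_space_diff by (auto simp: h_def)
  have fE: "(\<lambda>x. f x - E x) \<in> L2_space M"
    by (intro L2_space_diff f E)
  have "(\<integral>x. h x * (f x - E x) \<partial>M) = 0"
    using cond_exp_inner[OF G f h] L2_space_integrable_mult[OF h(1) f]
      L2_space_integrable_mult[OF h(1) E(1)]
    by (simp add: right_diff_distrib E_def)
  then have "(\<integral>x. (f x - E x)\<^sup>2 \<partial>M) = (\<integral>x. (f x - E x)\<^sup>2 + 2 * (h x * (f x - E x)) \<partial>M)"
    using L2_spaceD(2)[OF fE] L2_space_integrable_mult[OF h(1) fE] by simp
  also have "\<dots> \<le> (\<integral>x. (f x - g x)\<^sup>2 \<partial>M)"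
  proof (rule integral_mono)
    show "(f x - E x)\<^sup>2 + 2 * (h x * (f x - E x)) \<le> (f x - g x)\<^sup>2" for x
      using zero_le_power2[of "h x"] by (simp add: h_def power2_eq_square algebra_simps)
  qed (use L2_spaceD(2)[OF fE] L2_space_integrable_mult[OF h(1) fE] L2_spaceD(2)[OF L2_space_diff[OF f g(1)]] in auto)
  finally show ?thesis
    by (simp add: L2_norm_def E_def)
qed

end


section \<open>Convergence along a filtration\<close>

locale prob_filtration = prob_space M + filtration "space M" F
  for M :: "'a measure" and F :: "nat \<Rightarrow> 'a measure" +
  assumes subalg: "subalgebra M (F n)"
begin

lemma measurable_F_mono: "f \<in> borel_measurable (F m) \<Longrightarrow> m \<le> n \<Longrightarrow> f \<in> borel_measurable (F n)"
  using sets_F_mono[of m n] by (auto simp: measurable_def space_F)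

text \<open>
  Membership in the \<open>L\<^sup>2\<close>-closure of \<open>\<Union>n. L\<^sup>2(F n)\<close>. This closure is a closed linear subspace; a
  Dynkin system argument puts all indicators into it, and simple functions are dense.
\<close>

definition approximable :: "('a \<Rightarrow> real) \<Rightarrow> bool" where
  "approximable f \<longleftrightarrow> f \<in> L2_space M \<and> (\<forall>e>0. \<exists>n. \<exists>g\<in>L2_space M.
     g \<in> borel_measurable (F n) \<and> L2_norm M (\<lambda>x. f x - g x) < e)"

lemma approximable_measurable:
  assumes "f \<in> L2_space M" "f \<in> borel_measurable (F n)"
  shows "approximable f"
  unfolding approximable_def using assms by (auto intro!: exI[of _ n] bexI[of _ f] simp: L2_norm_zero)

lemma approximable_limit:
  assumes f: "f \<in> L2_space M"
    and s: "\<And>i::nat. approximable (s i)" and lim: "(\<lambda>i. L2_norm M (\<lambda>x. f x - s i x)) \<longlonglongrightarrow> 0"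
  shows "approximable f"
  unfolding approximable_def
proof (intro conjI allI impI f)
  fix e :: real assume "e > 0"
  then obtain i where i: "L2_norm M (\<lambda>x. f x - s i x) < e / 2"
    using order_tendstoD(2)[OF lim, of "e / 2"] by (auto simp: eventually_sequentially)
  obtain n g where g: "g \<in> L2_space M" "g \<in> borel_measurable (F n)" "L2_norm M (\<lambda>x. s i x - g x) < e / 2"
    using s[of i] \<open>e > 0\<close> half_gt_zero[of e] unfolding approximable_def by blast
  have "L2_norm M (\<lambda>x. (f x - s i x) + (s i x - g x)) \<le> L2_norm M (\<lambda>x. f x - s i x) + L2_norm M (\<lambda>x. s i x - g x)"
    using s[of i] by (intro L2_norm_triangle L2_space_diff f g) (auto simp: approximable_def)
  with i g show "\<exists>n. \<exists>g\<in>L2_space M. g \<in> borel_measurable (F n) \<and> L2_norm M (\<lambda>x. f x - g x) < e"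
    by (intro exI[of _ n] bexI[of _ g]) auto
qed

lemma approximable_add:
  assumes f: "approximable f" and f': "approximable f'"
  shows "approximable (\<lambda>x. f x + f' x)"
  unfolding approximable_def
proof (intro conjI allI impI)
  show "(\<lambda>x. f x + f' x) \<in> L2_space M"
    using f f' by (auto simp: approximable_def intro: L2_space_add)
  fix e :: real assume "e > 0"
  then have "e / 2 > 0" by simp
  with f obtain n g where g: "g \<in> L2_space M" "g \<in> borel_measurable (F n)" "L2_norm M (\<lambda>x. f x - g x) < e / 2"
    unfolding approximable_def by blast
  obtain n' g' where g': "g' \<in> L2_space M" "g' \<in> borel_measurable (F n')" "L2_norm M (\<lambda>x. f' x - g' x) < e / 2"
    using f' \<open>e / 2 > 0\<close> unfolding approximable_def by blast
  have "L2_norm M (\<lambda>x. (f x - g x) + (f' x - g' x)) \<le> L2_norm M (\<lambda>x. f x - g x) + L2_norm M (\<lambda>x. f' x - g' x)"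
    using f f' by (intro L2_norm_triangle L2_space_diff g g') (auto simp: approximable_def)
  moreover have "(\<lambda>x. g x + g' x) \<in> borel_measurable (F (max n n'))"
    using measurable_F_mono[OF g(2), of "max n n'"] measurable_F_mono[OF g'(2), of "max n n'"] by simp
  ultimately show "\<exists>n. \<exists>g\<in>L2_space M. g \<in> borel_measurable (F n) \<and> L2_norm M (\<lambda>x. f x + f' x - g x) < e"
    using g g' by (intro exI[of _ "max n n'"] bexI[of _ "\<lambda>x. g x + g' x"])
      (auto simp: L2_space_add algebra_simps)
qed

lemma approximable_cmult:
  assumes f: "approximable f"
  shows "approximable (\<lambda>x. c * f x)"
  unfolding approximable_def
proof (intro conjI allI impI)
  show "(\<lambda>x. c * f x) \<in> L2_space M"
    using f by (auto simp: approximable_def intro: L2_space_cmult)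
  fix e :: real assume "e > 0"
  then have "e / (\<bar>c\<bar> + 1) > 0" by simp
  with f obtain n g where g: "g \<in> L2_space M" "g \<in> borel_measurable (F n)"
      "L2_norm M (\<lambda>x. f x - g x) < e / (\<bar>c\<bar> + 1)"
    unfolding approximable_def by blast
  have "L2_norm M (\<lambda>x. c * f x - c * g x) = \<bar>c\<bar> * L2_norm M (\<lambda>x. f x - g x)"
    by (simp add: L2_norm_cmult flip: right_diff_distrib)
  also have "\<dots> \<le> (\<bar>c\<bar> + 1) * L2_norm M (\<lambda>x. f x - g x)"
    by (intro mult_right_mono L2_norm_nonneg) simp
  also have "\<dots> < e"
    using g(3) by (simp add: field_simps)
  finally show "\<exists>n. \<exists>g\<in>L2_space M. g \<in> borel_measurable (F n) \<and> L2_norm M (\<lambda>x. c * f x - g x) < e"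
    using g by (intro exI[of _ n] bexI[of _ "\<lambda>x. c * g x"]) (auto simp: L2_space_cmult)
qed

lemma approximable_sum:
  assumes "\<And>i. i \<in> I \<Longrightarrow> approximable (f i)"
  shows "approximable (\<lambda>x. \<Sum>i\<in>I. f i x)"
  using assms
  by (induction I rule: infinite_finite_induct)
     (auto intro: approximable_add approximable_measurable[of _ 0] L2_space_zero)

lemma approximable_indicator:
  assumes gen: "sets M = sigma_sets (space M) (\<Union>n. sets (F n))"
    and A: "A \<in> sets M"
  shows "approximable (indicator A)"
proof -
  have "Int_stable (\<Union>n. sets (F n))"
  proof (rule Int_stableI, elim UN_E)
    fix a b m n assume "a \<in> sets (F m)" "b \<in> sets (F n)"
    then have "a \<inter> b \<in> sets (F (max m n))"
      using sets_F_mono[of m "max m n"] sets_F_mono[of n "max m n"] by (intro sets.Int) auto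
    then show "a \<inter> b \<in> (\<Union>n. sets (F n))" by blast
  qed
  moreover have "(\<Union>n. sets (F n)) \<subseteq> Pow (space M)"
    using sets.sets_into_space space_F by blast
  moreover have "A \<in> sigma_sets (space M) (\<Union>n. sets (F n))"
    using A gen by simp
  ultimately show ?thesis
  proof (induction rule: sigma_sets_induct_disjoint)
    case (basic A)
    then obtain n where n: "A \<in> sets (F n)" by blast
    then have "A \<in> sets M"
      using subalg[of n] by (auto simp: subalgebra_def)
    with n show ?case
      by (intro approximable_measurable[of _ n] L2_space_indicator) auto
  next
    case empty
    show ?case using approximable_measurable[of "\<lambda>x. 0" 0] by (simp add: L2_space_zero indicator_def)
  next
    case (compl A)
    have "approximable (indicator (space M))"
      using sets.top[of "F 0"]
      by (intro approximable_measurable[of _ 0] L2_space_indicator) (auto simp: space_F)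
    \<comment> \<open>The indicator of the whole space, not the constant 1, so that the identity below
       also holds at points outside the space.\<close>
    from approximable_add[OF this approximable_cmult[OF compl(2), of "-1"]]
    have "approximable (\<lambda>x. indicator (space M) x + (-1) * indicator A x)" .
    moreover have "indicator (space M) x + (-1) * indicator A x = (indicator (space M - A) x :: real)" for x
      using compl(1) sets.sets_into_space[of A M] gen by (auto simp: indicator_def)
    ultimately show ?case by simp
  next
    case (union A)
    then have A: "A i \<in> sets M" for i using gen by auto
    show ?case
    proof (rule approximable_limit)
      show "indicator (\<Union>i. A i) \<in> L2_space M"
        using A by (intro L2_space_indicator) auto
      show "approximable (indicator (\<Union>i<n. A i))" for n
      proof -
        have "(indicator (\<Union>i<n. A i) :: 'a \<Rightarrow> real) = (\<lambda>x. \<Sum>i<n. indicator (A i) x)"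
          using union(1) by (intro ext indicator_UN_disjoint) (auto simp: disjoint_family_on_def)
        then show ?thesis using union(3) by (simp add: approximable_sum)
      qed
      show "(\<lambda>n. L2_norm M (\<lambda>x. indicator (\<Union>i. A i) x - indicator (\<Union>i<n. A i) x)) \<longlonglongrightarrow> 0"
        using A by (intro L2_dominated_convergence[OF L2_space_const[of 1]] LIMSEQ_indicator_UN) 
          (auto simp: indicator_def)
    qed
  qed
qed

lemma approximable_L2:
  assumes gen: "sets M = sigma_sets (space M) (\<Union>n. sets (F n))"
    and f: "f \<in> L2_space M"
  shows "approximable f"
proof -
  obtain s where s: "\<And>i. simple_function M (s i)"
      "\<And>x. x \<in> space M \<Longrightarrow> (\<lambda>i. s i x) \<longlonglongrightarrow> f x"
      "\<And>i x. x \<in> space M \<Longrightarrow> dist (s i x) 0 \<le> 2 * dist (f x) 0"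
    using borel_measurable_implies_sequence_metric[OF L2_spaceD(1)[OF f], of 0] by blast
  have simple: "approximable u" if "simple_function M u" for u
  proof -
    have "simple_function M u" "emeasure M {y \<in> space M. u y \<noteq> 0} \<noteq> \<infinity>"
      using that by auto
    then show ?thesis
    proof (induction rule: integrable_simple_function_induct)
      case (cong f g)
      have f: "f \<in> L2_space M"
        using cong(6) by (simp add: approximable_def)
      have "L2_norm M (\<lambda>x. g x - f x) = L2_norm M (\<lambda>x. 0)"
        unfolding L2_norm_def
        by (intro arg_cong[of _ _ sqrt] Bochner_Integration.integral_cong refl) (simp add: cong(5))
      moreover have "g \<in> L2_space M"
        by (intro L2_space_dominated[OF f] borel_measurable_simple_function cong(3) AE_I2) (simp add: cong(5))
      ultimately show ?case
        using cong(6) by (intro approximable_limit[of g "\<lambda>_. f"]) (simp_all add: L2_norm_zero)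
    next
      case (indicator A y)
      then show ?case
        using approximable_cmult[OF approximable_indicator[OF gen], of A y] by (simp add: mult.commute)
    next
      case (add f g)
      then show ?case by (intro approximable_add)
    qed
  qed
  show ?thesis
  proof (rule approximable_limit[OF f simple[OF s(1)]])
    show "(\<lambda>i. L2_norm M (\<lambda>x. f x - s i x)) \<longlonglongrightarrow> 0"
      using s f
      by (intro L2_dominated_convergence[where w = "\<lambda>x. 2 * \<bar>f x\<bar>"] L2_space_cmult L2_space_abs)
         (auto simp: borel_measurable_simple_function)
  qed
qed

text \<open>
  Levy's upward theorem in \<open>L\<^sup>2\<close>: a function close to \<open>f\<close> and measurable with respect to \<open>F m\<close> competes with
  the best approximation of \<open>f\<close> at every time \<open>n \<ge> m\<close>.
\<close>

lemma cond_exp_tendsto_L2: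
  assumes gen: "sets M = sigma_sets (space M) (\<Union>n. sets (F n))"
    and f: "f \<in> L2_space M"
  shows "(\<lambda>n. L2_norm M (\<lambda>x. f x - real_cond_exp M (F n) f x)) \<longlonglongrightarrow> 0"
proof (rule LIMSEQ_I)
  fix e :: real assume "e > 0"
  then obtain m g where g: "g \<in> L2_space M" "g \<in> borel_measurable (F m)" "L2_norm M (\<lambda>x. f x - g x) < e"
    using approximable_L2[OF gen f] unfolding approximable_def by blast
  have "L2_norm M (\<lambda>x. f x - real_cond_exp M (F n) f x) < e" if "m \<le> n" for n
    using cond_exp_best_approximation[OF subalg f g(1) measurable_F_mono[OF g(2) that]] g(3) by linarith
  then show "\<exists>m. \<forall>n\<ge>m. norm (L2_norm M (\<lambda>x. f x - real_cond_exp M (F n) f x) - 0) < e"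
    by (auto intro!: exI[of _ m] simp: L2_norm_nonneg)
qed


section \<open>The maximal inequality for adapted decompositions\<close>

lemma measurable_cond_exp_diff: "cond_exp_diff M F n f \<in> borel_measurable (F (Suc n))"
proof -
  have "real_cond_exp M (F n) f \<in> borel_measurable (F (Suc n))"
    by (rule measurable_F_mono[of _ n]) auto
  then show ?thesis unfolding cond_exp_diff_def by simp
qed

lemma L2_space_cond_exp_diff: "f \<in> L2_space M \<Longrightarrow> cond_exp_diff M F n f \<in> L2_space M"
  unfolding cond_exp_diff_def by (intro L2_space_diff L2_space_cond_exp subalg)

lemma cond_exp_diff_orthogonal:
  assumes f: "f \<in> L2_space M" and h: "h \<in> L2_space M" "h \<in> borel_measurable (F n)"
  shows "(\<integral>x. h x * cond_exp_diff M F n f x \<partial>M) = 0"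
proof -
  have h': "h \<in> borel_measurable (F (Suc n))"
    by (rule measurable_F_mono[OF h(2)]) simp
  have "(\<integral>x. h x * cond_exp_diff M F n f x \<partial>M) =
      (\<integral>x. h x * real_cond_exp M (F (Suc n)) f x \<partial>M) - (\<integral>x. h x * real_cond_exp M (F n) f x \<partial>M)"
    using L2_space_integrable_mult[OF h(1) L2_space_cond_exp[OF subalg f]]
    by (simp add: cond_exp_diff_def right_diff_distrib)
  then show ?thesis
    using cond_exp_inner[OF subalg f h(1) h'] cond_exp_inner[OF subalg f h] by simp
qed

lemma cond_exp_diff_zero: "L2_norm M (cond_exp_diff M F n (\<lambda>x. 0)) = 0"
proof -
  have zero: "AE x in M. real_cond_exp M (F n) (\<lambda>x. 0) x = 0" for n
    using sigma_finite_subalgebra.real_cond_exp_F_meas[OF sigma_finite_subalgebra_prob[OF subalg], of "\<lambda>x. 0"]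
    by simp
  have "AE x in M. (cond_exp_diff M F n (\<lambda>x. 0) x)\<^sup>2 = 0"
    using zero[of n] zero[of "Suc n"] by eventually_elim (simp add: cond_exp_diff_def)
  then have "(\<integral>x. (cond_exp_diff M F n (\<lambda>x. 0) x)\<^sup>2 \<partial>M) = 0"
    by (rule integral_eq_zero_AE)
  then show ?thesis by (simp add: L2_norm_def)
qed

text \<open>
  The terms on an upper diagonal are martingale differences for the filtration shifted by \<open>k\<close>.
\<close>

lemma upper_diagonal_maximal_inequality:
  assumes Z: "\<And>n. Z n \<in> L2_space M"
  shows "L2_norm M (\<lambda>x. running_max (\<lambda>N. \<Sum>n<N. cond_exp_diff M F (n + k) (Z n) x) P)
    \<le> 2 * sqrt (\<Sum>n<P. (L2_norm M (cond_exp_diff M F (n + k) (Z n)))\<^sup>2)"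
proof (rule martingale_maximal_inequality[where G = "\<lambda>n. F (n + k)"])
  show "cond_exp_diff M F (i + k) (Z i) \<in> borel_measurable (F (n + k))" if "i < n" for i n
    by (rule measurable_F_mono[OF measurable_cond_exp_diff]) (use that in simp)
qed (auto intro: L2_space_cond_exp_diff cond_exp_diff_orthogonal Z subalg)

text \<open>
  The terms on a lower diagonal start at time \<open>Suc k\<close>; before that they are set to zero, so that they
  are martingale differences for the delayed filtration \<open>F (n - Suc k)\<close>, which stays at \<open>F 0\<close> up to
  that time. Substituting \<open>n + Suc k\<close> for \<open>n\<close> gives the form of the bound used in the second hypothesis.
\<close>

lemma lower_diagonal_maximal_inequality:
  assumes Z: "\<And>n. Z n \<in> L2_space M"
  shows "L2_norm M (\<lambda>x. running_max (\<lambda>N. \<Sum>n<N. if k < n then cond_exp_diff M F (n - Suc k) (Z n) x else 0) P)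
    \<le> 2 * sqrt (\<Sum>n<P - Suc k. (L2_norm M (cond_exp_diff M F n (Z (n + Suc k))))\<^sup>2)"
proof -
  define d where "d = (\<lambda>n. if k < n then cond_exp_diff M F (n - Suc k) (Z n) else (\<lambda>x. 0))"
  have "L2_norm M (\<lambda>x. running_max (\<lambda>N. \<Sum>n<N. d n x) P) \<le> 2 * sqrt (\<Sum>n<P. (L2_norm M (d n))\<^sup>2)"
  proof (rule martingale_maximal_inequality[where G = "\<lambda>n. F (n - Suc k)"])
    show "d i \<in> borel_measurable (F (n - Suc k))" if "i < n" for i n
    proof (cases "k < i")
      case True
      have "cond_exp_diff M F (i - Suc k) (Z i) \<in> borel_measurable (F (n - Suc k))"
        by (rule measurable_F_mono[OF measurable_cond_exp_diff]) (use that True in simp)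
      with True show ?thesis by (simp add: d_def)
    qed (simp add: d_def)
  qed (auto simp: d_def intro: L2_space_cond_exp_diff L2_space_zero cond_exp_diff_orthogonal Z subalg)
  also have "(\<Sum>n<P. (L2_norm M (d n))\<^sup>2) = (\<Sum>n=Suc k..<P. (L2_norm M (cond_exp_diff M F (n - Suc k) (Z n)))\<^sup>2)"
    by (rule sum.mono_neutral_cong_right) (auto simp: d_def L2_norm_zero)
  also have "\<dots> = (\<Sum>n<P - Suc k. (L2_norm M (cond_exp_diff M F n (Z (n + Suc k))))\<^sup>2)"
    by (rule sum.reindex_bij_witness[where i = "\<lambda>n. n + Suc k" and j = "\<lambda>n. n - Suc k"]) auto
  finally show ?thesis
    by (simp add: d_def if_distribR cong: if_cong)
qed

lemma cond_exp_initial: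
  assumes triv: "sets (F 0) = {{}, space M}" and f: "f \<in> L2_space M" and mean: "(\<integral>x. f x \<partial>M) = 0"
  shows "AE x in M. real_cond_exp M (F 0) f x = 0"
proof -
  interpret sigma_finite_subalgebra M "F 0"
    by (rule sigma_finite_subalgebra_prob[OF subalg])
  show ?thesis
  proof (rule real_cond_exp_charact)
    fix A assume "A \<in> sets (F 0)"
    then show "(\<integral>x\<in>A. f x \<partial>M) = (\<integral>x\<in>A. 0 \<partial>M)"
      using triv set_integral_space[OF L2_space_integrable[OF f]] mean
      by (auto simp: set_lebesgue_integral_def)
  qed (auto intro: L2_space_integrable f)
qed

text \<open>
  The increments between times \<open>0\<close> and \<open>n + K\<close>, with those from time \<open>n\<close> on indexed forwards and the
  earlier ones backwards, which is the decomposition into diagonals. Extending the second sum by zeros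
  up to a bound \<open>P\<close> common to all \<open>n\<close> allows summation over \<open>n\<close> to be exchanged with it.
\<close>

lemma cond_exp_telescope:
  assumes "n \<le> P"
  shows "real_cond_exp M (F (n + K)) f x = real_cond_exp M (F 0) f x
    + (\<Sum>k<K. cond_exp_diff M F (n + k) f x)
    + (\<Sum>k<P. if k < n then cond_exp_diff M F (n - Suc k) f x else 0)"
proof -
  have "(\<Sum>k<K. cond_exp_diff M F (n + k) f x) = real_cond_exp M (F (n + K)) f x - real_cond_exp M (F n) f x"
    using sum_lessThan_telescope[of "\<lambda>k. real_cond_exp M (F (n + k)) f x" K] by (simp add: cond_exp_diff_def)
  moreover have "(\<Sum>k<P. if k < n then cond_exp_diff M F (n - Suc k) f x else 0)
      = (\<Sum>k<n. cond_exp_diff M F (n - Suc k) f x)"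
    using assms by (intro sum.mono_neutral_cong_right) auto
  moreover have "\<dots> = (\<Sum>k<n. cond_exp_diff M F k f x)"
    by (rule sum.nat_diff_reindex)
  moreover have "\<dots> = real_cond_exp M (F n) f x - real_cond_exp M (F 0) f x"
    using sum_lessThan_telescope[of "\<lambda>k. real_cond_exp M (F k) f x" n] by (simp add: cond_exp_diff_def)
  ultimately show ?thesis by simp
qed

text \<open>
  The triangle inequality over \<open>K\<close> upper and \<open>P\<close> lower diagonals, for the truncations \<open>E\<^sup>n\<^sup>+\<^sup>K Z\<^sub>n\<close>; the bound
  is uniform in \<open>K\<close> apart from the truncation errors \<open>r K n\<close>, of which only the finitely many with
  \<open>n < P\<close> enter, so that \<open>K \<rightarrow> \<infinity>\<close> removes them.
\<close>

theorem maximal_inequality: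
  assumes triv: "sets (F 0) = {{}, space M}"
    and gen: "sets M = sigma_sets (space M) (\<Union>n. sets (F n))"
    and Z: "\<And>n. Z n \<in> L2_space M" and mean: "\<And>n. (\<integral>x. Z n x \<partial>M) = 0"
    and upper: "sqrt_sums_finite (\<lambda>k n. (L2_norm M (cond_exp_diff M F (n + k) (Z n)))\<^sup>2)"
    and lower: "sqrt_sums_finite (\<lambda>k n. (L2_norm M (cond_exp_diff M F n (Z (n + Suc k))))\<^sup>2)"
  shows "L2_norm M (\<lambda>x. running_max (\<lambda>N. \<Sum>n<N. Z n x) P) \<le>
      2 * (\<Sum>k. sqrt (\<Sum>n. (L2_norm M (cond_exp_diff M F (n + k) (Z n)))\<^sup>2))
    + 2 * (\<Sum>k. sqrt (\<Sum>n. (L2_norm M (cond_exp_diff M F n (Z (n + Suc k))))\<^sup>2))"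
    (is "?max \<le> 2 * (\<Sum>k. sqrt (suminf (?a k))) + 2 * (\<Sum>k. sqrt (suminf (?b k)))")
proof -
  define r where "r = (\<lambda>K n x. Z n x - real_cond_exp M (F (n + K)) (Z n) x)"
  define U where "U = (\<lambda>k x. running_max (\<lambda>N. \<Sum>n<N. cond_exp_diff M F (n + k) (Z n) x) P)"
  define V where "V = (\<lambda>k x. running_max
      (\<lambda>N. \<Sum>n<N. if k < n then cond_exp_diff M F (n - Suc k) (Z n) x else 0) P)"
  have r_L2: "r K n \<in> L2_space M" for K n
    unfolding r_def by (intro L2_space_diff Z L2_space_cond_exp subalg)
  have U_L2: "U k \<in> L2_space M" for k
    unfolding U_def by (intro L2_space_running_max L2_space_sum L2_space_cond_exp_diff Z)
  have V_L2: "V k \<in> L2_space M" for k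
  proof -
    have "(\<lambda>x. if k < n then cond_exp_diff M F (n - Suc k) (Z n) x else 0) \<in> L2_space M" for n
      by (cases "k < n") (auto simp: L2_space_zero intro: L2_space_cond_exp_diff Z)
    then show ?thesis
      unfolding V_def by (intro L2_space_running_max L2_space_sum)
  qed
  have bound: "?max \<le> (\<Sum>n<P. L2_norm M (r K n))
      + (2 * (\<Sum>k. sqrt (suminf (?a k))) + 2 * (\<Sum>k. sqrt (suminf (?b k))))" for K
  proof -
    have "AE x in M. \<forall>n. real_cond_exp M (F 0) (Z n) x = 0"
      unfolding AE_all_countable by (intro allI cond_exp_initial triv Z mean)
    then have pointwise: "AE x in M. \<bar>running_max (\<lambda>N. \<Sum>n<N. Z n x) P\<bar>
        \<le> \<bar>(\<Sum>n<P. \<bar>r K n x\<bar>) + ((\<Sum>k<K. U k x) + (\<Sum>k<P. V k x))\<bar>"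
    proof eventually_elim
      case (elim x)
      let ?u = "\<lambda>k n. cond_exp_diff M F (n + k) (Z n) x"
      let ?v = "\<lambda>k n. if k < n then cond_exp_diff M F (n - Suc k) (Z n) x else 0"
      have "running_max (\<lambda>N. \<Sum>n<N. Z n x) P =
        running_max (\<lambda>N. (\<Sum>n<N. r K n x) + ((\<Sum>k<K. \<Sum>n<N. ?u k n) + (\<Sum>k<P. \<Sum>n<N. ?v k n))) P"
      proof (rule running_max_cong)
        fix N assume "N \<le> P"
        then have "Z n x = r K n x + ((\<Sum>k<K. ?u k n) + (\<Sum>k<P. ?v k n))" if "n < N" for n
          using cond_exp_telescope[of n P K "Z n" x] that elim by (simp add: r_def)
        then have "(\<Sum>n<N. Z n x) = (\<Sum>n<N. r K n x + ((\<Sum>k<K. ?u k n) + (\<Sum>k<P. ?v k n)))"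
          by (intro sum.cong) auto
        also have "\<dots> = (\<Sum>n<N. r K n x) + ((\<Sum>n<N. \<Sum>k<K. ?u k n) + (\<Sum>n<N. \<Sum>k<P. ?v k n))"
          by (simp only: sum.distrib)
        also have "(\<Sum>n<N. \<Sum>k<K. ?u k n) = (\<Sum>k<K. \<Sum>n<N. ?u k n)"
          by (rule sum.swap)
        also have "(\<Sum>n<N. \<Sum>k<P. ?v k n) = (\<Sum>k<P. \<Sum>n<N. ?v k n)"
          by (rule sum.swap)
        finally show "(\<Sum>n<N. Z n x) =
          (\<Sum>n<N. r K n x) + ((\<Sum>k<K. \<Sum>n<N. ?u k n) + (\<Sum>k<P. \<Sum>n<N. ?v k n))" .
      qed
      also have "\<dots> \<le> running_max (\<lambda>N. \<Sum>n<N. r K n x) P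
          + (running_max (\<lambda>N. \<Sum>k<K. \<Sum>n<N. ?u k n) P + running_max (\<lambda>N. \<Sum>k<P. \<Sum>n<N. ?v k n) P)"
        by (intro order_trans[OF running_max_add] add_left_mono running_max_add)
      also have "\<dots> \<le> (\<Sum>n<P. \<bar>r K n x\<bar>) + ((\<Sum>k<K. U k x) + (\<Sum>k<P. V k x))"
      proof (intro add_mono)
        show "running_max (\<lambda>N. \<Sum>n<N. r K n x) P \<le> (\<Sum>n<P. \<bar>r K n x\<bar>)"
          unfolding running_max_le_iff
          by (intro allI impI order_trans[OF sum_abs] sum_mono2) auto
      qed (simp_all only: U_def V_def running_max_sum)
      finally show ?case
        by (simp add: running_max_nonneg)
    qed
    have "?max \<le> L2_norm M (\<lambda>x. (\<Sum>n<P. \<bar>r K n x\<bar>) + ((\<Sum>k<K. U k x) + (\<Sum>k<P. V k x)))"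
      by (intro L2_norm_mono pointwise L2_space_add L2_space_sum L2_space_abs r_L2 U_L2 V_L2
          measurable_running_max borel_measurable_sum L2_spaceD(1) Z)
    also have "\<dots> \<le> L2_norm M (\<lambda>x. \<Sum>n<P. \<bar>r K n x\<bar>)
        + (L2_norm M (\<lambda>x. \<Sum>k<K. U k x) + L2_norm M (\<lambda>x. \<Sum>k<P. V k x))"
      by (intro order_trans[OF L2_norm_triangle] add_left_mono L2_norm_triangle
          L2_space_add L2_space_sum L2_space_abs r_L2 U_L2 V_L2)
    also have "\<dots> \<le> (\<Sum>n<P. L2_norm M (\<lambda>x. \<bar>r K n x\<bar>))
        + ((\<Sum>k<K. L2_norm M (U k)) + (\<Sum>k<P. L2_norm M (V k)))"
      by (intro add_mono L2_norm_triangle_sum L2_space_abs r_L2 U_L2 V_L2)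
    also have "\<dots> \<le> (\<Sum>n<P. L2_norm M (r K n))
        + (2 * (\<Sum>k. sqrt (suminf (?a k))) + 2 * (\<Sum>k. sqrt (suminf (?b k))))"
    proof (intro add_mono)
      show "(\<Sum>n<P. L2_norm M (\<lambda>x. \<bar>r K n x\<bar>)) \<le> (\<Sum>n<P. L2_norm M (r K n))"
        by (simp add: L2_norm_def)
      have "L2_norm M (U k) \<le> 2 * sqrt (suminf (?a k))" for k
      proof -
        have "(\<Sum>n<P. ?a k n) \<le> suminf (?a k)"
          using upper by (intro sum_le_suminf) (auto simp: sqrt_sums_finite_def)
        then have "2 * sqrt (\<Sum>n<P. ?a k n) \<le> 2 * sqrt (suminf (?a k))"
          by simp
        then show ?thesis
          unfolding U_def
          by (rule order_trans[OF upper_diagonal_maximal_inequality[where Z = Z and k = k and P = P, OF Z]])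
      qed
      then have "(\<Sum>k<K. L2_norm M (U k)) \<le> 2 * (\<Sum>k<K. sqrt (suminf (?a k)))"
        unfolding sum_distrib_left by (rule sum_mono)
      also have "(\<Sum>k<K. sqrt (suminf (?a k))) \<le> (\<Sum>k. sqrt (suminf (?a k)))"
        using upper by (intro sum_le_suminf) (auto simp: sqrt_sums_finite_def suminf_nonneg)
      finally show "(\<Sum>k<K. L2_norm M (U k)) \<le> 2 * (\<Sum>k. sqrt (suminf (?a k)))"
        by simp
      have "L2_norm M (V k) \<le> 2 * sqrt (suminf (?b k))" for k
      proof -
        have "(\<Sum>n<P - Suc k. ?b k n) \<le> suminf (?b k)"
          using lower by (intro sum_le_suminf) (auto simp: sqrt_sums_finite_def)
        then have "2 * sqrt (\<Sum>n<P - Suc k. ?b k n) \<le> 2 * sqrt (suminf (?b k))"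
          by simp
        then show ?thesis
          unfolding V_def
          by (rule order_trans[OF lower_diagonal_maximal_inequality[where Z = Z and k = k and P = P, OF Z]])
      qed
      then have "(\<Sum>k<P. L2_norm M (V k)) \<le> 2 * (\<Sum>k<P. sqrt (suminf (?b k)))"
        unfolding sum_distrib_left by (rule sum_mono)
      also have "(\<Sum>k<P. sqrt (suminf (?b k))) \<le> (\<Sum>k. sqrt (suminf (?b k)))"
        using lower by (intro sum_le_suminf) (auto simp: sqrt_sums_finite_def suminf_nonneg)
      finally show "(\<Sum>k<P. L2_norm M (V k)) \<le> 2 * (\<Sum>k. sqrt (suminf (?b k)))"
        by simp
    qed
    finally show ?thesis .
  qed
  have "(\<lambda>K. L2_norm M (r K n)) \<longlonglongrightarrow> 0" for n
    using LIMSEQ_ignore_initial_segment[OF cond_exp_tendsto_L2[OF gen Z[of n]], of n]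
    by (simp add: r_def add.commute)
  then have "(\<lambda>K. (\<Sum>n<P. L2_norm M (r K n))
      + (2 * (\<Sum>k. sqrt (suminf (?a k))) + 2 * (\<Sum>k. sqrt (suminf (?b k)))))
    \<longlonglongrightarrow> (\<Sum>n<P. 0) + (2 * (\<Sum>k. sqrt (suminf (?a k))) + 2 * (\<Sum>k. sqrt (suminf (?b k))))"
    by (intro tendsto_intros)
  then have "?max \<le> (\<Sum>n<P. 0) + (2 * (\<Sum>k. sqrt (suminf (?a k))) + 2 * (\<Sum>k. sqrt (suminf (?b k))))"
    by (rule LIMSEQ_le_const) (use bound in blast)
  then show ?thesis by simp
qed

end


section \<open>From uniform tail bounds to convergence\<close>

text \<open>
  Dominated convergence is used twice: for the inner series with majorant \<open>a k\<close>, and, since the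
  square roots inherit the domination, for the outer one.
\<close>

lemma sqrt_sums_tendsto_zero:
  fixes b :: "nat \<Rightarrow> nat \<Rightarrow> nat \<Rightarrow> real"
  assumes a: "sqrt_sums_finite a"
    and b: "\<And>m k n. 0 \<le> b m k n" "\<And>m k n. b m k n \<le> a k n"
    and lim: "\<And>k n. (\<lambda>m. b m k n) \<longlonglongrightarrow> 0"
  shows "sqrt_sums_finite (b m)" and "(\<lambda>m. \<Sum>k. sqrt (\<Sum>n. b m k n)) \<longlonglongrightarrow> 0"
proof -
  have a': "summable (a k)" "summable (\<lambda>k. sqrt (suminf (a k)))" for k
    using a by (auto simp: sqrt_sums_finite_def)
  have b': "summable (b m k)" for m k
    by (rule summable_comparison_test'[OF a'(1)[of k]]) (use b in auto)
  have le: "sqrt (suminf (b m k)) \<le> sqrt (suminf (a k))" for m k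
    by (intro real_sqrt_le_mono suminf_le b b' a')
  have nonneg: "0 \<le> sqrt (suminf (b m k))" for m k
    by (simp add: suminf_nonneg b b')
  have "summable (\<lambda>k. sqrt (suminf (b m k)))" for m
    by (rule summable_comparison_test'[OF a'(2)]) (use le nonneg in auto)
  then show "sqrt_sums_finite (b m)"
    using b' by (simp add: sqrt_sums_finite_def)
  have "(\<lambda>m. suminf (b m k)) \<longlonglongrightarrow> (\<Sum>n. 0)" for k
    using tannerys_theorem[of "\<lambda>n m. b m k n" "\<lambda>n. 0" sequentially "a k"] lim a'(1) b
    by (auto intro!: always_eventually)
  from tendsto_real_sqrt[OF this]
  have "(\<lambda>m. sqrt (suminf (b m k))) \<longlonglongrightarrow> 0" for k
    by simp
  then have "(\<lambda>m. \<Sum>k. sqrt (suminf (b m k))) \<longlonglongrightarrow> (\<Sum>k. 0)"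
    using tannerys_theorem[of "\<lambda>k m. sqrt (suminf (b m k))" "\<lambda>k. 0" sequentially "\<lambda>k. sqrt (suminf (a k))"]
      a'(2) le nonneg
    by (auto intro!: always_eventually)
  then show "(\<lambda>m. \<Sum>k. sqrt (\<Sum>n. b m k n)) \<longlonglongrightarrow> 0" by simp
qed

text \<open>
  Let \<open>G m\<close> be the squared oscillation \<open>sup\<^sub>N |Z\<^sub>m + \<dots> + Z\<^sub>N|\<^sup>2\<close>, with values in the extended nonnegative
  reals. By monotone convergence its integral is at most \<open>(e m)\<^sup>2\<close>. Hence \<open>inf\<^sub>m G m\<close> has integral zero and
  vanishes almost surely, which is the Cauchy property of the partial sums. The same \<open>G m\<close>
  dominates the squared distance from the \<open>m\<close>-th partial sum to the limit, whence convergence in \<open>L\<^sup>2\<close>.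
\<close>

lemma series_converges_of_maximal_tails:
  fixes e :: "nat \<Rightarrow> real"
  assumes Z: "\<And>n. Z n \<in> L2_space M"
    and tail: "\<And>m P. L2_norm M (\<lambda>x. running_max (\<lambda>N. \<Sum>n=m..<N. Z n x) P) \<le> e m"
    and e: "e \<longlonglongrightarrow> 0"
  shows "(AE x in M. summable (\<lambda>n. Z n x)) \<and> (\<exists>S. L2_tendsto M (\<lambda>N x. \<Sum>n<N. Z n x) S)"
proof -
  have Z_meas [measurable]: "Z n \<in> borel_measurable M" for n
    using Z by blast
  define Y where "Y = (\<lambda>m P x. running_max (\<lambda>N. \<Sum>n=m..<N. Z n x) P)"
  define G where "G = (\<lambda>m x. SUP P. ennreal ((Y m P x)\<^sup>2))"
  have Y_L2: "Y m P \<in> L2_space M" for m P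
    unfolding Y_def by (intro L2_space_running_max L2_space_sum Z)
  have Y_meas [measurable]: "Y m P \<in> borel_measurable M" for m P
    using Y_L2 by blast
  have G_meas [measurable]: "G m \<in> borel_measurable M" for m
    unfolding G_def by measurable
  have e_nonneg: "0 \<le> e m" for m
    using tail[of m 0] L2_norm_nonneg order_trans by blast
  have Y_mono: "Y m P x \<le> Y m Q x" if "P \<le> Q" for m P Q x
    unfolding Y_def running_max_le_iff using that
    by (auto intro: abs_le_running_max)
  have partial_le: "ennreal ((\<Sum>n=m..<N. Z n x)\<^sup>2) \<le> G m x" for m N x
  proof -
    have "\<bar>\<Sum>n=m..<N. Z n x\<bar> \<le> Y m N x"
      unfolding Y_def by (rule abs_le_running_max) simp
    then have "(\<Sum>n=m..<N. Z n x)\<^sup>2 \<le> (Y m N x)\<^sup>2"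
      using abs_le_square_iff by fastforce
    then show ?thesis
      unfolding G_def by (intro SUP_upper2[of N] ennreal_leI) auto
  qed
  have G_int: "(\<integral>\<^sup>+x. G m x \<partial>M) \<le> ennreal ((e m)\<^sup>2)" for m
  proof -
    have "incseq (\<lambda>P x. ennreal ((Y m P x)\<^sup>2))"
      by (intro incseq_SucI le_funI ennreal_leI power_mono Y_mono) (auto simp: Y_def running_max_nonneg)
    then have "(\<integral>\<^sup>+x. G m x \<partial>M) = (SUP P. \<integral>\<^sup>+x. ennreal ((Y m P x)\<^sup>2) \<partial>M)"
      unfolding G_def by (intro nn_integral_monotone_convergence_SUP) auto
    also have "\<dots> \<le> ennreal ((e m)\<^sup>2)"
    proof (rule SUP_least)
      fix P
      have "(\<integral>\<^sup>+x. ennreal ((Y m P x)\<^sup>2) \<partial>M) = ennreal ((L2_norm M (Y m P))\<^sup>2)"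
        unfolding L2_norm_power2 by (intro nn_integral_eq_integral L2_spaceD(2) Y_L2) auto
      also have "\<dots> \<le> ennreal ((e m)\<^sup>2)"
        using tail[of m P] by (intro ennreal_leI power_mono L2_norm_nonneg) (simp add: Y_def)
      finally show "(\<integral>\<^sup>+x. ennreal ((Y m P x)\<^sup>2) \<partial>M) \<le> ennreal ((e m)\<^sup>2)" .
    qed
    finally show ?thesis .
  qed
  have "(\<integral>\<^sup>+x. (INF m. G m x) \<partial>M) \<le> ennreal ((e m)\<^sup>2)" for m
    by (rule order_trans[OF nn_integral_mono G_int]) (auto intro: INF_lower)
  moreover have "(\<lambda>m. ennreal ((e m)\<^sup>2)) \<longlonglongrightarrow> ennreal (0\<^sup>2)"
    by (intro tendsto_ennrealI tendsto_power e)
  ultimately have "(\<integral>\<^sup>+x. (INF m. G m x) \<partial>M) \<le> ennreal (0\<^sup>2)"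
    by (intro LIMSEQ_le_const) auto
  then have "AE x in M. (INF m. G m x) = 0"
    by (simp add: nn_integral_0_iff_AE)
  then have conv: "AE x in M. summable (\<lambda>n. Z n x)"
  proof eventually_elim
    case (elim x)
    show ?case
      unfolding summable_Cauchy
    proof (intro allI impI)
      fix c :: real assume "c > 0"
      then have "(INF m. G m x) < ennreal ((c / 2)\<^sup>2)"
        by (simp add: elim)
      then obtain m where m: "G m x < ennreal ((c / 2)\<^sup>2)"
        by (auto simp: INF_less_iff)
      have small: "\<bar>\<Sum>n=m..<N. Z n x\<bar> < c / 2" for N
      proof -
        have "ennreal ((\<Sum>n=m..<N. Z n x)\<^sup>2) < ennreal ((c / 2)\<^sup>2)"
          using partial_le m by (rule order_le_less_trans)
        then have "(\<Sum>n=m..<N. Z n x)\<^sup>2 < (c / 2)\<^sup>2"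
          by (simp add: ennreal_less_iff)
        then show ?thesis
          using abs_le_square_iff[of "c / 2" "\<Sum>n=m..<N. Z n x"] \<open>c > 0\<close> by auto
      qed
      have "norm (\<Sum>n=p..<q. Z n x) < c" if "m \<le> p" for p q
      proof (cases "p \<le> q")
        case True
        have "(\<Sum>n=m..<p. Z n x) + (\<Sum>n=p..<q. Z n x) = (\<Sum>n=m..<q. Z n x)"
          by (rule sum.atLeastLessThan_concat[OF that True])
        then show ?thesis using small[of p] small[of q] by simp
      next
        case False
        then show ?thesis using \<open>c > 0\<close> by simp
      qed
      then show "\<exists>m. \<forall>p\<ge>m. \<forall>q. norm (\<Sum>n=p..<q. Z n x) < c" by blast
    qed
  qed
  define S where "S = (\<lambda>x. \<Sum>n. Z n x)"
  have S_meas [measurable]: "S \<in> borel_measurable M"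
    unfolding S_def by measurable
  have "AE x in M. ennreal (((\<Sum>n<m. Z n x) - S x)\<^sup>2) \<le> G m x" for m
    using conv
  proof eventually_elim
    case (elim x)
    have "(\<lambda>N. (\<Sum>n<N. Z n x) - (\<Sum>n<m. Z n x)) \<longlonglongrightarrow> S x - (\<Sum>n<m. Z n x)"
      unfolding S_def by (intro tendsto_intros summable_LIMSEQ elim)
    moreover have "\<forall>\<^sub>F N in sequentially. (\<Sum>n<N. Z n x) - (\<Sum>n<m. Z n x) = (\<Sum>n=m..<N. Z n x)"
      using eventually_ge_at_top[of m]
      by eventually_elim (simp add: sum_diff_nat_ivl lessThan_atLeast0)
    ultimately have "(\<lambda>N. \<Sum>n=m..<N. Z n x) \<longlonglongrightarrow> S x - (\<Sum>n<m. Z n x)"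
      using tendsto_cong by fast
    then have "(\<lambda>N. ennreal ((\<Sum>n=m..<N. Z n x)\<^sup>2)) \<longlonglongrightarrow> ennreal ((S x - (\<Sum>n<m. Z n x))\<^sup>2)"
      by (intro tendsto_ennrealI tendsto_power)
    then have "ennreal ((S x - (\<Sum>n<m. Z n x))\<^sup>2) \<le> G m x"
      by (rule LIMSEQ_le_const2) (use partial_le in blast)
    then show ?case by (simp add: power2_commute)
  qed
  then have dist: "(\<integral>\<^sup>+x. ennreal (((\<Sum>n<m. Z n x) - S x)\<^sup>2) \<partial>M) \<le> ennreal ((e m)\<^sup>2)" for m
    by (intro order_trans[OF nn_integral_mono_AE G_int])
  \<comment> \<open>The case \<open>m = 0\<close>, an empty partial sum, is what puts \<open>S\<close> itself into \<open>L\<^sup>2\<close>.\<close>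
  have diff_L2: "(\<lambda>x. (\<Sum>n<m. Z n x) - S x) \<in> L2_space M" for m
  proof -
    have "integrable M (\<lambda>x. ((\<Sum>n<m. Z n x) - S x)\<^sup>2)"
      using dist[of m] by (intro integrableI_nonneg) (auto intro: order_le_less_trans)
    then show ?thesis by (simp add: L2_space_def)
  qed
  have "L2_norm M (\<lambda>x. (\<Sum>n<m. Z n x) - S x) \<le> e m" for m
  proof -
    have "ennreal ((L2_norm M (\<lambda>x. (\<Sum>n<m. Z n x) - S x))\<^sup>2) \<le> ennreal ((e m)\<^sup>2)"
      using dist[of m] nn_integral_eq_integral[OF L2_spaceD(2)[OF diff_L2[of m]]]
      by (simp add: L2_norm_power2)
    then have "(L2_norm M (\<lambda>x. (\<Sum>n<m. Z n x) - S x))\<^sup>2 \<le> (e m)\<^sup>2"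
      by simp
    then show ?thesis
      by (rule power2_le_imp_le[OF _ e_nonneg])
  qed
  then have "(\<lambda>N. L2_norm M (\<lambda>x. (\<Sum>n<N. Z n x) - S x)) \<longlonglongrightarrow> 0"
    by (intro tendsto_sandwich[OF _ _ tendsto_const e]) (auto simp: L2_norm_nonneg)
  moreover have "S \<in> L2_space M"
    using L2_space_cmult[OF diff_L2[of 0], of "-1"] by simp
  ultimately have "L2_tendsto M (\<lambda>N x. \<Sum>n<N. Z n x) S"
    unfolding L2_tendsto_def by (auto intro: L2_space_sum Z)
  with conv show ?thesis by blast
qed

theorem theoremA:
  fixes M :: "'a measure"
    and F :: "nat \<Rightarrow> 'a measure"
    and Z :: "nat \<Rightarrow> 'a \<Rightarrow> real"
  assumes "prob_space M"
    and "\<And>n. subalgebra M (F n)"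
    and "filtration (space M) F"
    and "sets (F 0) = {{}, space M}"
    and "sets M = sigma_sets (space M) (\<Union>n. sets (F n))"
    and "\<And>n. Z n \<in> L2_space M"
    and "\<And>n. (\<integral>x. Z n x \<partial>M) = 0"
    and "sqrt_sums_finite (\<lambda>k n. (L2_norm M (cond_exp_diff M F (n + k) (Z n)))\<^sup>2)"
    and "sqrt_sums_finite (\<lambda>k n. (L2_norm M (cond_exp_diff M F n (Z (n + Suc k))))\<^sup>2)"
  shows "(AE x in M. summable (\<lambda>n. Z n x)) \<and>
         (\<exists>S. L2_tendsto M (\<lambda>N x. \<Sum>n<N. Z n x) S)"
proof -
  interpret prob_filtration M F
    by (intro prob_filtration.intro prob_filtration_axioms.intro assms)
  \<comment> \<open>Cutting off the first \<open>m\<close> terms only deletes entries of the two double series.\<close>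
  define Z' where "Z' = (\<lambda>m n. if m \<le> n then Z n else (\<lambda>x. 0))"
  define a where "a = (\<lambda>m k n. (L2_norm M (cond_exp_diff M F (n + k) (Z' m n)))\<^sup>2)"
  define b where "b = (\<lambda>m k n. (L2_norm M (cond_exp_diff M F n (Z' m (n + Suc k))))\<^sup>2)"
  have a_lim: "(\<lambda>m. a m k n) \<longlonglongrightarrow> 0" for k n
    by (rule tendsto_eventually, use eventually_gt_at_top[of n] in eventually_elim)
       (simp add: a_def Z'_def cond_exp_diff_zero)
  have b_lim: "(\<lambda>m. b m k n) \<longlonglongrightarrow> 0" for k n
    by (rule tendsto_eventually, use eventually_gt_at_top[of "n + Suc k"] in eventually_elim)
       (simp add: b_def Z'_def cond_exp_diff_zero)
  have a_le: "a m k n \<le> (L2_norm M (cond_exp_diff M F (n + k) (Z n)))\<^sup>2" for m k n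
    by (simp add: a_def Z'_def cond_exp_diff_zero)
  have b_le: "b m k n \<le> (L2_norm M (cond_exp_diff M F n (Z (n + Suc k))))\<^sup>2" for m k n
    by (simp add: b_def Z'_def cond_exp_diff_zero)
  have nonneg: "0 \<le> a m k n" "0 \<le> b m k n" for m k n
    by (simp_all add: a_def b_def)
  note a_tail = sqrt_sums_tendsto_zero[OF assms(8) nonneg(1) a_le a_lim]
  note b_tail = sqrt_sums_tendsto_zero[OF assms(9) nonneg(2) b_le b_lim]
  define e where "e = (\<lambda>m. 2 * (\<Sum>k. sqrt (\<Sum>n. a m k n)) + 2 * (\<Sum>k. sqrt (\<Sum>n. b m k n)))"
  show ?thesis
  proof (rule series_converges_of_maximal_tails[where e = e])
    show "Z n \<in> L2_space M" for n by fact
    have "(\<lambda>m. 2 * (\<Sum>k. sqrt (\<Sum>n. a m k n)) + 2 * (\<Sum>k. sqrt (\<Sum>n. b m k n))) \<longlonglongrightarrow> 2 * 0 + 2 * 0"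
      by (intro tendsto_intros a_tail b_tail)
    then show "e \<longlonglongrightarrow> 0" by (simp add: e_def)
    fix m P
    have "(\<Sum>n<N. Z' m n x) = (\<Sum>n=m..<N. Z n x)" for N x
      by (rule sum.mono_neutral_cong_right) (auto simp: Z'_def)
    moreover have "L2_norm M (\<lambda>x. running_max (\<lambda>N. \<Sum>n<N. Z' m n x) P) \<le> e m"
      unfolding e_def a_def b_def
    proof (rule maximal_inequality[OF assms(4,5)])
      show "Z' m n \<in> L2_space M" for n
        using assms(6) by (simp add: Z'_def L2_space_zero)
      show "(\<integral>x. Z' m n x \<partial>M) = 0" for n
        using assms(7) by (simp add: Z'_def)
    qed (use a_tail(1)[of m] b_tail(1)[of m] in \<open>simp_all add: a_def b_def\<close>)
    ultimately show "L2_norm M (\<lambda>x. running_max (\<lambda>N. \<Sum>n=m..<N. Z n x) P) \<le> e m"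
      by simp
  qed
qed

end
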